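(* Let $D \ge 2$ be an integer. For $\zeta_1,\ldots,\zeta_{D-1},\sigma_1,\ldots,\sigma_D \in \mathbb{R}$, let $\mathbf{K}_{stable} = \mathbf{K}_{stable}(\zeta_1,\ldots,\zeta_{D-1},\sigma_1,\ldots,\sigma_D) \in \mathbb{R}^{D\times D}$ be the tridiagonal matrix $$\mathbf{K}_{stable} = \begin{bmatrix} -\sigma_1^2 & \zeta_1 & & \\ -\zeta_1 & \ddots & \ddots & \\ & \ddots & \ddots & \zeta_{D-1} \\ & & -\zeta_{D-1} & -\sigma_D^2 \end{bmatrix},$$ that is, $(\mathbf{K}_{stable})_{i,i} = -\sigma_i^2$ for $1\le i\le D$, $(\mathbf{K}_{stable})_{i,i+1} = \zeta_i$ and $(\mathbf{K}_{stable})_{i+1,i} = -\zeta_i$ for $1\le i\le D-1$, and all other entries are $0$. Then: (1) For every diagonalizable real matrix $\mathbf{K} \in \mathbb{R}^{D\times D}$ all of whose eigenvalues have non-positive real part, there exist $\zeta_1,\ldots,\zeta_{D-1},\sigma_1,\ldots,\sigma_D \in \mathbb{R}$ such that the corresponding $\mathbf{K}_{stable}$ is similar to $\mathbf{K}$ over $\mathbb{R}$ (i.e. there is an invertible $\mathbf{P}\in\mathbb{R}^{D\times D}$ with $\mathbf{K} = \mathbf{P}\,\mathbf{K}_{stable}\,\mathbf{P}^{-1}$). (2) For all $\zeta_1,\ldots,\zeta_{D-1},\sigma_1,\ldots,\sigma_D \in \mathbb{R}$, every (complex) eigenvalue of the corresponding $\mathbf{K}_{stable}$ has non-positive real part.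
   Context: Eigenvalues of a real matrix are its complex eigenvalues. A real matrix $\mathbf{K}\in\mathbb{R}^{D\times D}$ is called diagonalizable if it is diagonalizable over $\mathbb{C}$, i.e. $\mathbf{K} = \mathbf{M}\mathbf{J}\mathbf{M}^{-1}$ for some $\mathbf{M},\mathbf{J}\in\mathbb{C}^{D\times D}$ with $\mathbf{M}$ invertible and $\mathbf{J}$ diagonal. *)

theory Defs
  imports Complex_Main "Jordan_Normal_Form.Char_Poly"
begin

abbreviation complexify :: "real mat \<Rightarrow> complex mat" where
  "complexify A \<equiv> map_mat complex_of_real A"

definition diagonalizable_over_C :: "real mat \<Rightarrow> bool" where
  "diagonalizable_over_C K \<longleftrightarrow> (\<exists>J. diagonal_mat J \<and> similar_mat (complexify K) J)"

(* Matrix positions are counted from 0, whereas the parameters zeta_1, ..., zeta_(D-1) and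
   sigma_1, ..., sigma_D keep their indices starting from 1; values of zeta and sigma outside
   these index ranges do not enter the matrix. *)
definition K_stable :: "nat \<Rightarrow> (nat \<Rightarrow> real) \<Rightarrow> (nat \<Rightarrow> real) \<Rightarrow> real mat" where
  "K_stable D \<zeta> \<sigma> = mat D D (\<lambda>(i, j).
     if j = i then - (\<sigma> (Suc i))\<^sup>2
     else if j = Suc i then \<zeta> (Suc i)
     else if i = Suc j then - \<zeta> (Suc j)
     else 0)"

end

theory Submission
  imports Defs
begin

text \<open>
  For the spectral bound, the off-diagonal part of a stable matrix is skew-symmetric, so for an
  eigenvector \<open>v\<close> with eigenvalue \<open>z\<close> it contributes only an imaginary amount to the Hermitian
  form \<open>v\<^sup>* K v = z |v|\<^sup>2\<close>. Taking real parts leaves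
  \<open>Re z |v|\<^sup>2 = - \<Sum>\<^sub>i \<sigma>\<^sub>i\<^sup>2 |v\<^sub>i|\<^sup>2 \<le> 0\<close> (\<open>eigenvalue_K_stable_Re_nonpos\<close>).

  For the existence of a stable normal form, a block-diagonal matrix suffices: a real eigenvalue
  \<open>a \<le> 0\<close> is realised by the \<open>1 \<times> 1\<close> block \<open>- (\<surd>(- a))\<^sup>2\<close> and a conjugate pair \<open>a \<plusminus> b \<i>\<close> by the
  \<open>2 \<times> 2\<close> block with rows \<open>(a, b)\<close> and \<open>(- b, a)\<close>; setting \<open>\<zeta>\<close> to \<open>0\<close> between two
  consecutive blocks keeps the matrix in the required tridiagonal family. Hence every finite
  conjugation-invariant multiset in the closed left half plane is the diagonal of a diagonal matrix
  that is similar over \<open>\<complex>\<close> to some stable matrix (\<open>stable_matrix_with_spectrum\<close>). The spectrum of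
  a real diagonalizable \<open>K\<close> is such a multiset, and a diagonal matrix is determined up to
  similarity by the multiset of its entries, so \<open>K\<close> and the stable matrix are similar over \<open>\<complex>\<close>.
  Finally, real matrices that are similar over \<open>\<complex>\<close> are similar over \<open>\<real>\<close>
  (\<open>similar_real_if_similar_complex\<close>), which avoids choosing real bases of eigenspaces.
\<close>

section \<open>Similarity of diagonal matrices\<close>

text \<open>
  The diagonal lists the roots of the characteristic polynomial with multiplicity, and similar
  matrices share that polynomial.
\<close>
lemma similar_diagonal_mset:
  fixes A B :: "complex mat"
  assumes sim: "similar_mat A B" and "diagonal_mat A" "diagonal_mat B"
  shows "mset (diag_mat A) = mset (diag_mat B)"
proof -
  have pr: "proots (char_poly M) = mset (diag_mat M)"
    if "M \<in> carrier_mat n n" "diagonal_mat M" for M :: "complex mat" and n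
  proof -
    have "upper_triangular M"
      using that unfolding upper_triangular_def diagonal_mat_def by auto
    then have "char_poly M = (\<Prod>a\<leftarrow>diag_mat M. [:- a, 1:])"
      by (rule char_poly_upper_triangular[OF that(1)])
    moreover have "proots (\<Prod>a\<leftarrow>as. [:- a, 1:]) = mset as" for as :: "complex list"
    proof (induction as)
      case (Cons a as)
      have "(\<Prod>a\<leftarrow>as. [:- a, 1:]) \<noteq> 0" by (auto simp: prod_list_zero_iff)
      then show ?case using Cons by (simp add: proots_mult del: mult_pCons_left)
    qed auto
    ultimately show ?thesis by simp
  qed
  obtain n where "A \<in> carrier_mat n n" "B \<in> carrier_mat n n"
    using similar_matD[OF sim] by auto
  then show ?thesis
    using pr assms char_poly_similar[OF sim] by metis
qed

text \<open>
  Renumbering rows and columns simultaneously is conjugation by a permutation matrix.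
\<close>
lemma similar_permuted_indices:
  fixes A :: "'a :: field mat"
  assumes A: "A \<in> carrier_mat n n" and p: "p permutes {..<n}"
  shows "similar_mat (mat n n (\<lambda>(i, j). A $$ (p i, p j))) A"
proof -
  define P :: "'a mat" where "P = mat n n (\<lambda>(i, j). if j = p i then 1 else 0)"
  define Q :: "'a mat" where "Q = mat n n (\<lambda>(i, j). if i = p j then 1 else 0)"
  have P: "P \<in> carrier_mat n n" and Q: "Q \<in> carrier_mat n n" by (auto simp: P_def Q_def)
  have lt: "p i < n" if "i < n" for i using permutes_in_image[OF p, of i] that by simp
  have eq: "p i = p j \<longleftrightarrow> i = j" for i j using permutes_inj[OF p] by (auto dest: injD)
  have PB: "(P * B) $$ (i, j) = B $$ (p i, j)"
    if "i < n" "j < n" "B \<in> carrier_mat n n" for i j and B :: "'a mat"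
    using that lt[of i] by (simp add: P_def scalar_prod_def if_distrib[of "\<lambda>x. x * _"] sum.delta cong: if_cong)
  have BQ: "(B * Q) $$ (i, j) = B $$ (i, p j)"
    if "i < n" "j < n" "B \<in> carrier_mat n n" for i j and B :: "'a mat"
    using that lt[of j] by (simp add: Q_def scalar_prod_def if_distrib[of "\<lambda>x. _ * x"] sum.delta cong: if_cong)
  have PQ: "P * Q = 1\<^sub>m n"
    by (rule eq_matI) (use P Q in \<open>auto simp del: index_mult_mat(1) simp: PB[OF _ _ Q], auto simp: Q_def lt eq\<close>)
  have QP: "Q * P = 1\<^sub>m n"
    by (rule mat_mult_left_right_inverse[OF P Q PQ])
  have "mat n n (\<lambda>(i, j). A $$ (p i, p j)) = P * A * Q"
    by (rule eq_matI) (use P Q A in \<open>auto simp del: index_mult_mat(1) assoc_mult_mat simp: BQ[of _ _ "P * A"] PB[OF _ _ A] lt\<close>)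
  with A P Q PQ QP show ?thesis by (intro similar_matI[of _ _ P Q n]) auto
qed

lemma similar_diagonal_if_mset_eq:
  fixes A B :: "'a :: field mat"
  assumes A: "A \<in> carrier_mat n n" "diagonal_mat A"
    and B: "B \<in> carrier_mat m m" "diagonal_mat B"
    and eq: "mset (diag_mat A) = mset (diag_mat B)"
  shows "similar_mat A B"
proof -
  have "length (diag_mat A) = length (diag_mat B)"
    using mset_eq_length[OF eq] .
  then have mn: "m = n" using A B by (simp add: diag_mat_def)
  obtain p where p: "p permutes {..<n}" and pA: "permute_list p (diag_mat B) = diag_mat A"
    using mset_eq_permutation[OF eq] B mn by (auto simp: diag_mat_def)
  have lt: "p i < n" if "i < n" for i using permutes_in_image[OF p, of i] that by simp
  have inj: "p i = p j \<longleftrightarrow> i = j" for i j using permutes_inj[OF p] by (auto dest: injD)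
  have "A = mat n n (\<lambda>(i, j). B $$ (p i, p j))"
  proof (rule eq_matI)
    fix i j
    assume "i < dim_row (mat n n (\<lambda>(i, j). B $$ (p i, p j)))"
      and "j < dim_col (mat n n (\<lambda>(i, j). B $$ (p i, p j)))"
    then have ij: "i < n" "j < n" by auto
    show "A $$ (i, j) = mat n n (\<lambda>(i, j). B $$ (p i, p j)) $$ (i, j)"
    proof (cases "i = j")
      case True
      have "diag_mat A ! i = diag_mat B ! p i"
        unfolding pA[symmetric] using ij B mn p by (subst permute_list_nth) (auto simp: diag_mat_def)
      with True show ?thesis using ij A B mn lt by (simp add: diag_mat_def)
    next
      case False
      then show ?thesis using ij A B mn lt inj unfolding diagonal_mat_def by auto
    qed
  qed (use A in auto)
  with similar_permuted_indices[OF B(1)[unfolded mn] p] show ?thesis by simp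
qed

section \<open>Descending similarity from the complex to the real numbers\<close>

text \<open>
  If \<open>P = X + \<i> Y\<close> intertwines the real matrices \<open>A\<close> and \<open>B\<close>, comparing real and imaginary parts
  shows that \<open>X\<close> and \<open>Y\<close> do as well, and so does every real combination \<open>X + t Y\<close>. The polynomial
  \<open>det (X + t Y)\<close> in \<open>t\<close> does not vanish at \<open>t = \<i>\<close>, so it is nonzero and some real \<open>t\<close> avoids
  its finitely many roots.
\<close>
lemma similar_real_if_similar_complex:
  fixes A B :: "real mat"
  assumes "similar_mat (complexify A) (complexify B)"
  shows "similar_mat A B"
proof -
  from similar_matD[OF assms] obtain n P Q where
    carr: "complexify A \<in> carrier_mat n n" "complexify B \<in> carrier_mat n n"
      and P: "P \<in> carrier_mat n n" and Q: "Q \<in> carrier_mat n n"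
      and PQ: "P * Q = 1\<^sub>m n" and QP: "Q * P = 1\<^sub>m n"
      and AB: "complexify A = P * complexify B * Q" by auto
  have A: "A \<in> carrier_mat n n" and B: "B \<in> carrier_mat n n" using carr by auto
  have intertw: "complexify A * P = P * complexify B"
  proof -
    have "complexify A * P = P * complexify B * (Q * P)"
      unfolding AB using P Q carr by (simp add: assoc_mult_mat[of _ n n _ n _ n])
    then show ?thesis using P carr by (simp add: QP)
  qed
  define R where "R t = map_mat Re P + t \<cdot>\<^sub>m map_mat Im P" for t :: real
  have R: "R t \<in> carrier_mat n n" for t using P by (simp add: R_def)
  have AR: "A * R t = R t * B" for t
  proof -
    \<comment> \<open>Both \<open>Re\<close> and \<open>Im\<close> are linear over the reals, which is all that the argument uses.\<close>
    have part: "A * map_mat f P = map_mat f P * B"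
      if f: "\<And>x r. f (complex_of_real r * x) = r * f x" "\<And>x y. f (x + y) = f x + f y" "f 0 = 0"
      for f :: "complex \<Rightarrow> real"
    proof (rule eq_matI)
      fix i j assume "i < dim_row (map_mat f P * B)" "j < dim_col (map_mat f P * B)"
      then have ij: "i < n" "j < n" using P B by auto
      have fs: "f (sum g I) = (\<Sum>i\<in>I. f (g i))" for g and I :: "nat set"
        by (induction I rule: infinite_finite_induct) (auto simp: f)
      have f': "f (x * complex_of_real r) = f x * r" for x r
        using f(1)[of r x] by (simp add: mult.commute)
      have "f ((complexify A * P) $$ (i, j)) = f ((P * complexify B) $$ (i, j))"
        by (simp add: intertw)
      then show "(A * map_mat f P) $$ (i, j) = (map_mat f P * B) $$ (i, j)"
        using ij A B P by (simp add: scalar_prod_def fs f f')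
    qed (use A B P in auto)
    have "A * R t = A * map_mat Re P + t \<cdot>\<^sub>m (A * map_mat Im P)"
      unfolding R_def using A P by (simp add: mult_add_distrib_mat[of _ n n _ n] mult_smult_distrib[of _ n n _ n])
    also have "\<dots> = map_mat Re P * B + t \<cdot>\<^sub>m (map_mat Im P * B)"
      by (simp add: part)
    also have "\<dots> = R t * B"
      unfolding R_def using B P by (simp add: add_mult_distrib_mat[of _ n n _ _ n] mult_smult_assoc_mat[of _ n n _ n])
    finally show ?thesis .
  qed
  obtain t where t: "det (R t) \<noteq> 0"
  proof -
    \<comment> \<open>The matrix \<open>X + t Y\<close> with polynomial entries in the indeterminate \<open>t\<close>.\<close>
    define F where "F = mat n n (\<lambda>ij. [:complex_of_real (Re (P $$ ij)), complex_of_real (Im (P $$ ij)):])"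
    have ev: "poly (det F) z = det (map_mat (\<lambda>p. poly p z) F)" for z
      by (rule comm_ring_hom.hom_det[OF poly_hom.comm_ring_hom_axioms, symmetric])
    have "map_mat (\<lambda>p. poly p \<i>) F = P"
      by (rule eq_matI) (use P in \<open>auto simp: F_def complex_eq_iff\<close>)
    moreover have "det P \<noteq> 0"
      using det_mult[OF P Q] PQ by auto
    ultimately have "det F \<noteq> 0" using ev[of \<i>] by auto
    then have "finite {z. poly (det F) z = 0}" by (rule poly_roots_finite)
    moreover have "infinite (range complex_of_real)"
      using finite_imageD[of complex_of_real UNIV] infinite_UNIV_char_0 inj_of_real by blast
    ultimately obtain t where "poly (det F) (complex_of_real t) \<noteq> 0"
      by (metis (mono_tags, lifting) finite_subset image_subsetI mem_Collect_eq)
    moreover have "map_mat (\<lambda>p. poly p (complex_of_real t)) F = complexify (R t)"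
      by (rule eq_matI) (use P in \<open>auto simp: F_def R_def\<close>)
    ultimately have "det (R t) \<noteq> 0" by (auto simp: ev of_real_hom.hom_det)
    with that show ?thesis .
  qed
  obtain S where S: "S \<in> carrier_mat n n" and RS: "R t * S = 1\<^sub>m n" and SR: "S * R t = 1\<^sub>m n"
    using det_non_zero_imp_unit[OF R t, of "()"] unfolding Units_def ring_mat_def by auto
  have "A = A * (R t * S)" using A RS by simp
  also have "\<dots> = R t * B * S"
    using A R[of t] S by (simp add: AR flip: assoc_mult_mat[of _ n n _ n _ n])
  finally have "A = R t * B * S" .
  with A B R S RS SR show ?thesis by (intro similar_matI) auto
qed

section \<open>Stable matrices with prescribed spectrum\<close>

lemma K_stable_carrier [simp]: "K_stable n \<zeta> \<sigma> \<in> carrier_mat n n"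
  by (simp add: K_stable_def)

text \<open>
  The parameter with index \<open>m\<close> couples the last coordinate of the first block to the first
  coordinate of the second one, so making it \<open>0\<close> decouples the two blocks.
\<close>
lemma K_stable_direct_sum:
  "four_block_mat (K_stable m \<zeta> \<sigma>) (0\<^sub>m m n) (0\<^sub>m n m) (K_stable n \<zeta>' \<sigma>')
   = K_stable (m + n) (\<lambda>k. if k < m then \<zeta> k else if k = m then 0 else \<zeta>' (k - m))
       (\<lambda>k. if k \<le> m then \<sigma> k else \<sigma>' (k - m))" (is "?L = ?R")
proof (rule eq_matI)
  fix i j assume "i < dim_row ?R" "j < dim_col ?R"
  then have ij: "i < m + n" "j < m + n" by (auto simp: K_stable_def)
  consider "i < m" "j < m" | "i < m" "m \<le> j" | "m \<le> i" "j < m" | "m \<le> i" "m \<le> j" by linarith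
  then show "?L $$ (i, j) = ?R $$ (i, j)"
  proof cases
    case 4
    then obtain a b where "i = m + a" "j = m + b" by (metis le_Suc_ex)
    with ij show ?thesis by (simp add: K_stable_def)
  qed (use ij in \<open>auto simp: K_stable_def\<close>)
qed (auto simp: K_stable_def)

lemma exists_stable_block_real:
  assumes "a \<le> 0"
  shows "\<exists>\<zeta> \<sigma>. complexify (K_stable 1 \<zeta> \<sigma>) = mat 1 1 (\<lambda>_. complex_of_real a)"
proof (intro exI)
  show "complexify (K_stable 1 (\<lambda>_. 0) (\<lambda>_. sqrt (- a))) = mat 1 1 (\<lambda>_. complex_of_real a)"
    by (rule eq_matI) (use assms in \<open>auto simp: K_stable_def\<close>)
qed

text \<open>
  The real matrix with rows \<open>(a, b)\<close> and \<open>(- b, a)\<close> has the eigenvectors \<open>(1, \<i>)\<close> and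
  \<open>(1, - \<i>)\<close> for the eigenvalues \<open>a + b \<i>\<close> and \<open>a - b \<i>\<close>; they form the columns of the
  transformation matrix below.
\<close>
lemma exists_stable_block_conj_pair:
  assumes "Re z \<le> 0"
  shows "\<exists>\<zeta> \<sigma>. similar_mat (complexify (K_stable 2 \<zeta> \<sigma>)) (mat_diag 2 (\<lambda>i. if i = 0 then z else cnj z))"
proof (intro exI)
  let ?K = "complexify (K_stable 2 (\<lambda>_. Im z) (\<lambda>_. sqrt (- Re z)))"
  let ?J = "mat_diag 2 (\<lambda>i. if i = 0 then z else cnj z)"
  define P where "P = mat 2 2 (\<lambda>(i, j). if i = 0 then 1 else if j = 0 then \<i> else - \<i>)"
  define Q where "Q = mat 2 2 (\<lambda>(i, j). if j = 0 then 1 / 2 else if i = 0 then - \<i> / 2 else \<i> / 2)"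
  have carr: "P \<in> carrier_mat 2 2" "Q \<in> carrier_mat 2 2" by (auto simp: P_def Q_def)
  have lt2: "i < 2 \<longleftrightarrow> i = 0 \<or> i = 1" for i :: nat by auto
  have PQ: "P * Q = 1\<^sub>m 2"
    by (rule eq_matI) (auto simp: P_def Q_def scalar_prod_def lt2 numeral_2_eq_2)
  have "?K = P * ?J * Q"
    by (rule eq_matI)
      (use assms in \<open>auto simp: P_def Q_def mat_diag_def K_stable_def scalar_prod_def lt2 numeral_2_eq_2 complex_eq_iff\<close>)
  then show "similar_mat ?K ?J"
    using carr PQ mat_mult_left_right_inverse[OF carr PQ] by (intro similar_matI[of _ _ P Q 2]) auto
qed

text \<open>
  The induction splits off a real element, or a non-real element together with its conjugate;
  what remains is again invariant under conjugation. The diagonal matrix is asserted to exist rather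
  than prescribed because the order of its entries is dictated by the splitting.
\<close>
lemma stable_matrix_with_spectrum:
  fixes M :: "complex multiset"
  assumes "image_mset cnj M = M" and "\<And>z. z \<in># M \<Longrightarrow> Re z \<le> 0"
  shows "\<exists>\<zeta> \<sigma> J. J \<in> carrier_mat (size M) (size M) \<and> diagonal_mat J \<and> mset (diag_mat J) = M
           \<and> similar_mat (complexify (K_stable (size M) \<zeta> \<sigma>)) J"
  using assms
proof (induction "size M" arbitrary: M rule: less_induct)
  case less
  \<comment> \<open>A block realising \<open>L\<close> is put in front of the stable matrix that the induction hypothesis
    provides for the rest \<open>N\<close>.\<close>
  have glue: ?case
    if M: "M = L + N" and L: "L \<noteq> {#}" and NN: "image_mset cnj N = N"
      and J: "J \<in> carrier_mat (size L) (size L)" "diagonal_mat J" "mset (diag_mat J) = L"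
      and sim: "similar_mat (complexify (K_stable (size L) \<zeta> \<sigma>)) J" for L N J \<zeta> \<sigma>
  proof -
    have "size N < size M" using M L by (simp add: nonempty_has_size)
    then obtain \<zeta>' \<sigma>' J' where J': "J' \<in> carrier_mat (size N) (size N)" "diagonal_mat J'"
        "mset (diag_mat J') = N" and sim': "similar_mat (complexify (K_stable (size N) \<zeta>' \<sigma>')) J'"
      using less.hyps[of N] NN less.prems(2) M by auto
    let ?l = "size L" and ?n = "size N"
    let ?B = "\<lambda>X Y. four_block_mat X (0\<^sub>m ?l ?n) (0\<^sub>m ?n ?l) Y"
    have "similar_mat (?B (complexify (K_stable ?l \<zeta> \<sigma>)) (complexify (K_stable ?n \<zeta>' \<sigma>'))) (?B J J')"
      by (rule similar_mat_four_block_0_0[OF sim sim']) auto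
    also have "?B (complexify (K_stable ?l \<zeta> \<sigma>)) (complexify (K_stable ?n \<zeta>' \<sigma>'))
        = complexify (?B (K_stable ?l \<zeta> \<sigma>) (K_stable ?n \<zeta>' \<sigma>'))"
      by (rule eq_matI) (auto simp: K_stable_def)
    finally have "similar_mat (complexify (?B (K_stable ?l \<zeta> \<sigma>) (K_stable ?n \<zeta>' \<sigma>'))) (?B J J')" .
    moreover have "?B J J' \<in> carrier_mat (size M) (size M)" using J J' M by auto
    moreover have "diagonal_mat (?B J J')"
      using J J' unfolding diagonal_mat_def by auto
    moreover have "mset (diag_mat (?B J J')) = M"
      using J J' M by (subst diag_four_block_mat[of _ ?l _ ?n]) auto
    ultimately show ?thesis
      unfolding K_stable_direct_sum M size_union by blast
  qed
  show ?case
  proof (cases "M = {#}")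
    case True
    have "similar_mat (complexify (K_stable 0 \<zeta> \<sigma>)) (0\<^sub>m 0 0)" for \<zeta> \<sigma>
    proof -
      have "complexify (K_stable 0 \<zeta> \<sigma>) = 0\<^sub>m 0 0" by (rule eq_matI) (auto simp: K_stable_def)
      then show ?thesis by (simp add: similar_mat_refl[of _ 0])
    qed
    then show ?thesis using True
      by (intro exI[of _ "\<lambda>_. 0"] exI[of _ "0\<^sub>m 0 0"]) (auto simp: diagonal_mat_def diag_mat_def)
  next
    case False
    then obtain z N where zN: "M = add_mset z N" by (metis multiset_cases)
    have Rez: "Re z \<le> 0" using less.prems(2) zN by auto
    have cl: "add_mset (cnj z) (image_mset cnj N) = add_mset z N" using less.prems(1) zN by simp
    show ?thesis
    proof (cases "cnj z = z")
      case True
      then have z: "z = complex_of_real (Re z)" by (simp add: complex_eq_iff)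
      obtain \<zeta> \<sigma> where "complexify (K_stable 1 \<zeta> \<sigma>) = mat 1 1 (\<lambda>_. z)"
        using exists_stable_block_real[OF Rez] z by metis
      then show ?thesis
        by (intro glue[of "{#z#}" N "mat 1 1 (\<lambda>_. z)" \<zeta> \<sigma>])
          (use zN cl True in \<open>auto simp: diagonal_mat_def diag_mat_def intro: similar_mat_refl[of _ 1]\<close>)
    next
      case False
      then have "cnj z \<in># N" using cl by (metis insert_noteq_member)
      then obtain N' where N': "N = add_mset (cnj z) N'" by (metis multi_member_split)
      obtain \<zeta> \<sigma> where
        "similar_mat (complexify (K_stable 2 \<zeta> \<sigma>)) (mat_diag 2 (\<lambda>i. if i = 0 then z else cnj z))"
        using exists_stable_block_conj_pair[OF Rez] by metis
      then show ?thesis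
        by (intro glue[of "{#z, cnj z#}" N' "mat_diag 2 (\<lambda>i. if i = 0 then z else cnj z)" \<zeta> \<sigma>])
          (use zN N' cl in \<open>auto simp: diagonal_mat_def diag_mat_def mat_diag_def numeral_2_eq_2 add_mset_commute\<close>)
    qed
  qed
qed

section \<open>Reduction of diagonalizable matrices to stable form\<close>

lemma similar_mat_map_cnj:
  assumes "similar_mat A B"
  shows "similar_mat (map_mat cnj A) (map_mat cnj B)"
proof -
  interpret comm_ring_hom cnj by unfold_locales auto
  from similar_matD[OF assms] obtain n P Q where
    carr: "A \<in> carrier_mat n n" "B \<in> carrier_mat n n" "P \<in> carrier_mat n n" "Q \<in> carrier_mat n n"
    and eqs: "P * Q = 1\<^sub>m n" "Q * P = 1\<^sub>m n" "A = P * B * Q" by auto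
  show ?thesis
  proof (rule similar_matI[of _ _ "map_mat cnj P" "map_mat cnj Q" n])
    show "map_mat cnj P * map_mat cnj Q = 1\<^sub>m n" "map_mat cnj Q * map_mat cnj P = 1\<^sub>m n"
      using eqs carr by (metis mat_hom_mult mat_hom_one)+
    show "map_mat cnj A = map_mat cnj P * map_mat cnj B * map_mat cnj Q"
      unfolding eqs(3) using carr by (simp add: mat_hom_mult[of _ n n _ n])
  qed (use carr in auto)
qed

lemma similar_to_K_stable:
  assumes K: "K \<in> carrier_mat n n" and "diagonalizable_over_C K"
    and ev: "\<And>z. eigenvalue (complexify K) z \<Longrightarrow> Re z \<le> 0"
  shows "\<exists>\<zeta> \<sigma>. similar_mat K (K_stable n \<zeta> \<sigma>)"
proof -
  obtain J where J: "diagonal_mat J" and sim: "similar_mat (complexify K) J"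
    using assms unfolding diagonalizable_over_C_def by blast
  have Jc: "J \<in> carrier_mat n n" using similar_matD[OF sim] K by auto
  let ?M = "mset (diag_mat J)"
  have sz: "size ?M = n" using Jc by (simp add: diag_mat_def)
  \<comment> \<open>A real matrix equals its conjugate, so its diagonal form \<open>J\<close> is similar to the conjugate
    of \<open>J\<close>; hence the spectrum is invariant under conjugation.\<close>
  have "map_mat cnj (complexify K) = complexify K" by (rule eq_matI) auto
  then have "similar_mat J (map_mat cnj J)"
    using similar_mat_map_cnj[OF sim] similar_mat_trans[OF similar_mat_sym[OF sim]] by simp
  moreover have "diagonal_mat (map_mat cnj J)" using J unfolding diagonal_mat_def by auto
  ultimately have "?M = mset (diag_mat (map_mat cnj J))"
    by (rule similar_diagonal_mset[OF _ J])
  also have "\<dots> = image_mset cnj ?M"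
    using Jc by (auto simp: diag_mat_def simp flip: mset_map intro!: arg_cong[of _ _ mset])
  finally have closed: "image_mset cnj ?M = ?M" by simp
  have "Re z \<le> 0" if "z \<in># ?M" for z
  proof -
    have "z \<in> set (diag_mat J)" using that by simp
    moreover have "char_poly (complexify K) = (\<Prod>a\<leftarrow>diag_mat J. [:- a, 1:])"
      unfolding char_poly_similar[OF sim]
      by (rule char_poly_upper_triangular[OF Jc])
        (use J Jc in \<open>auto simp: upper_triangular_def diagonal_mat_def\<close>)
    ultimately have "poly (char_poly (complexify K)) z = 0"
      by (auto simp: poly_prod_list prod_list_zero_iff)
    then show ?thesis using ev eigenvalue_root_char_poly[of "complexify K" n] K by auto
  qed
  from stable_matrix_with_spectrum[OF closed this] obtain \<zeta> \<sigma> J' where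
    J': "J' \<in> carrier_mat n n" "diagonal_mat J'" "mset (diag_mat J') = ?M"
    and sim': "similar_mat (complexify (K_stable n \<zeta> \<sigma>)) J'"
    unfolding sz by auto
  have "similar_mat J J'"
    by (rule similar_diagonal_if_mset_eq[OF Jc J J'(1,2)]) (simp add: J'(3))
  then have "similar_mat (complexify K) (complexify (K_stable n \<zeta> \<sigma>))"
    using sim similar_mat_sym[OF sim'] similar_mat_trans by blast
  then show ?thesis using similar_real_if_similar_complex by blast
qed

section \<open>Eigenvalues of stable matrices\<close>

text \<open>
  The real part of \<open>cnj (v i) * v j\<close> is symmetric in \<open>i\<close> and \<open>j\<close>, so against an \<open>A\<close> that is
  skew-symmetric off the diagonal all terms with \<open>i \<noteq> j\<close> cancel in pairs.
\<close>
lemma Re_quadratic_form: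
  fixes A :: "nat \<Rightarrow> nat \<Rightarrow> real" and v :: "nat \<Rightarrow> complex"
  assumes skew: "\<And>i j. i < n \<Longrightarrow> j < n \<Longrightarrow> i \<noteq> j \<Longrightarrow> A j i = - A i j"
  shows "Re (\<Sum>i<n. \<Sum>j<n. cnj (v i) * (A i j * v j)) = (\<Sum>i<n. A i i * (cmod (v i))\<^sup>2)"
proof -
  define q where "q i j = A i j * (Re (v i) * Re (v j) + Im (v i) * Im (v j))" for i j
  have Re_q: "Re (\<Sum>i<n. \<Sum>j<n. cnj (v i) * (A i j * v j)) = (\<Sum>i<n. \<Sum>j<n. q i j)"
    by (simp add: q_def algebra_simps)
  have "2 * (\<Sum>i<n. \<Sum>j<n. q i j) = (\<Sum>i<n. \<Sum>j<n. q i j) + (\<Sum>i<n. \<Sum>j<n. q j i)"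
    using sum.swap[of q "{..<n}" "{..<n}"] by simp
  also have "\<dots> = (\<Sum>i<n. \<Sum>j<n. q i j + q j i)" by (simp add: sum.distrib)
  also have "\<dots> = (\<Sum>i<n. \<Sum>j<n. if j = i then 2 * q i i else 0)"
  proof (intro sum.cong refl)
    fix i j assume "i \<in> {..<n}" "j \<in> {..<n}"
    then have "A j i = - A i j" if "j \<noteq> i" using skew[of i j] that by simp
    then show "q i j + q j i = (if j = i then 2 * q i i else 0)"
      by (cases "j = i") (simp_all add: q_def algebra_simps)
  qed
  also have "\<dots> = 2 * (\<Sum>i<n. q i i)"
    by (simp add: sum.delta sum_distrib_left)
  finally have "(\<Sum>i<n. \<Sum>j<n. q i j) = (\<Sum>i<n. q i i)" by simp
  with Re_q show ?thesis
    by (simp add: q_def cmod_def power2_eq_square)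
qed

text \<open>
  Pairing the eigenvector equation with the eigenvector makes the right-hand side the eigenvalue
  times the positive number \<open>s = |v|\<^sup>2\<close>; the real part of the left-hand side only sees the
  non-positive diagonal.
\<close>
lemma eigenvalue_K_stable_Re_nonpos:
  assumes "eigenvalue (complexify (K_stable n \<zeta> \<sigma>)) z"
  shows "Re z \<le> 0"
proof -
  let ?K = "K_stable n \<zeta> \<sigma>"
  obtain v where v: "v \<in> carrier_vec n" "v \<noteq> 0\<^sub>v n" and Kv: "complexify ?K *\<^sub>v v = z \<cdot>\<^sub>v v"
    using assms unfolding eigenvalue_def eigenvector_def by (auto simp: K_stable_def)
  define s where "s = (\<Sum>i<n. (cmod (v $ i))\<^sup>2)"
  have row: "(\<Sum>j<n. ?K $$ (i, j) * v $ j) = z * v $ i" if "i < n" for i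
  proof -
    have "(complexify ?K *\<^sub>v v) $ i = (\<Sum>j<n. ?K $$ (i, j) * v $ j)"
      using that v carrier_matD[OF K_stable_carrier[of n \<zeta> \<sigma>]]
      by (simp add: scalar_prod_def atLeast0LessThan)
    then show ?thesis using that v by (simp add: Kv)
  qed
  have "(\<Sum>i<n. \<Sum>j<n. cnj (v $ i) * (?K $$ (i, j) * v $ j)) = (\<Sum>i<n. cnj (v $ i) * (z * v $ i))"
    by (simp add: row flip: sum_distrib_left)
  also have "\<dots> = z * complex_of_real s"
    by (simp add: s_def sum_distrib_left mult_ac complex_norm_square del: of_real_power)
  finally have "Re z * s = (\<Sum>i<n. ?K $$ (i, i) * (cmod (v $ i))\<^sup>2)"
    using Re_quadratic_form[of n "\<lambda>i j. ?K $$ (i, j)" "($) v"] by (simp add: K_stable_def)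
  also have "\<dots> \<le> 0"
    by (intro sum_nonpos) (auto simp: K_stable_def mult_nonpos_nonneg)
  finally have "Re z * s \<le> 0" .
  moreover have "s > 0"
  proof -
    obtain i where "i < n" "v $ i \<noteq> 0" using v by (metis carrier_vecD eq_vecI index_zero_vec)
    then show ?thesis unfolding s_def by (intro sum_pos2[of _ i]) auto
  qed
  ultimately show ?thesis by (simp add: mult_le_0_iff)
qed

theorem theorem2p1:
  fixes D :: nat
  assumes "D \<ge> 2"
  shows "(\<forall>K :: real mat. K \<in> carrier_mat D D \<longrightarrow> diagonalizable_over_C K \<longrightarrow>
            (\<forall>z :: complex. eigenvalue (complexify K) z \<longrightarrow> Re z \<le> 0) \<longrightarrow>
            (\<exists>(\<zeta> :: nat \<Rightarrow> real) (\<sigma> :: nat \<Rightarrow> real). similar_mat K (K_stable D \<zeta> \<sigma>)))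
       \<and> (\<forall>(\<zeta> :: nat \<Rightarrow> real) (\<sigma> :: nat \<Rightarrow> real) (z :: complex).
            eigenvalue (complexify (K_stable D \<zeta> \<sigma>)) z \<longrightarrow> Re z \<le> 0)"
  using similar_to_K_stable eigenvalue_K_stable_Re_nonpos by blast

end
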